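(* Let $p$ be an odd prime. Every ramification point $[\tau]_0\in\mathfrak{B}_p\subset X_0(p)$ corresponds to a unique class $\kappa$, namely the class of the lattice $[1,\tau]=\mathbb{Z}+\mathbb{Z}\tau$, where $\kappa\in \mathrm{Cl}\,\mathcal{O}_{\mathcal{K}}$ if $p\equiv 1 \pmod 4$, and $\kappa\in \mathrm{Cl}\,\mathcal{O}_{\mathcal{K}}\sqcup \mathrm{Cl}\,\mathcal{O}$ if $p\equiv 3\pmod 4$. That is, if $\tau$ is in the upper half-plane with $[\tau]_0\in\mathfrak{B}_p$, then $[1,\tau]$ is a proper fractional ideal of $\mathcal{O}_{\mathcal{K}}$ (if $p\equiv 1\pmod 4$), respectively of exactly one of $\mathcal{O}_{\mathcal{K}}$, $\mathcal{O}$ (if $p\equiv 3\pmod 4$), and its ideal class depends only on $[\tau]_0$.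
   Context: $X_0(p)$ is the compact modular curve $\Gamma_0(p)\backslash H^*$, where $H$ is the upper half-plane and $H^*=H\cup\mathbb{Q}\cup\{\infty\}$; $[\tau]_0$ denotes the class $\Gamma_0(p)\tau$. The matrix $\omega_p=\begin{pmatrix}0&1\\-p&0\end{pmatrix}$ acts on $H$ by $\tau\mapsto -1/(p\tau)$ and induces an involution $\widetilde{\omega}_p$ of $X_0(p)$. $\mathfrak{B}_p$ is the set of points of $X_0(p)$ fixed by $\widetilde{\omega}_p$, i.e. the set of ramification points of the quotient map $\pi_\omega: X_0(p)\to\Sigma=X_0(p)/\widetilde{\omega}_p$ (these are never cusps, since $\widetilde\omega_p$ exchanges the two cusps $[0]_0$ and $[\infty]_0$). $\mathcal{K}=\mathbb{Q}(\sqrt{-p})\subset\mathbb{C}$, $\mathcal{O}_{\mathcal{K}}=[1,\beta_{-p}]$ is its ring of integers and $\mathcal{O}=[1,2\beta_{-p}]$ its order of conductor $2$, where $[x,y]=\mathbb{Z}x+\mathbb{Z}y$, $\beta_{-p}=\sqrt{-p}$ if $p\equiv 1\pmod 4$ and $\beta_{-p}=\frac{1+\sqrt{-p}}{2}$ if $p\equiv 3\pmod 4$. For an order $R$ of $\mathcal{K}$, a proper fractional $R$-ideal is a lattice $\mathfrak{a}\subset\mathcal{K}$ with $\{x\in\mathcal{K}: x\mathfrak{a}\subset\mathfrak{a}\}=R$, and $\mathrm{Cl}\,R$ is the group of proper fractional $R$-ideals modulo multiplication by $\mathcal{K}^*$. The union of the two class groups is taken as a disjoint union. *)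

theory Defs
  imports
    "HOL-Analysis.Analysis"
    "HOL-Algebra.Coset"
    "HOL-Computational_Algebra.Primes"
    "HOL-Computational_Algebra.Group_Closure"
begin

datatype cplane = Fin complex | Infty

fun moebius :: "int^2^2 \<Rightarrow> cplane \<Rightarrow> cplane" where
  "moebius A (Fin z) =
     (if of_int (A$2$1) * z + of_int (A$2$2) = 0 then Infty
      else Fin ((of_int (A$1$1) * z + of_int (A$1$2)) / (of_int (A$2$1) * z + of_int (A$2$2))))"
| "moebius A Infty =
     (if A$2$1 = 0 then Infty else Fin (of_int (A$1$1) / of_int (A$2$1)))"

definition upper_half_plane :: "complex set" where
  "upper_half_plane = {z. Im z > 0}"

definition extended_upper_half_plane :: "cplane set" where
  "extended_upper_half_plane = Fin ` upper_half_plane \<union> Fin ` \<rat> \<union> {Infty}"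

definition Gamma0 :: "nat \<Rightarrow> (int^2^2) set" where
  "Gamma0 p = {A. det A = 1 \<and> int p dvd A$2$1}"

definition Gamma0_orbit :: "nat \<Rightarrow> cplane \<Rightarrow> cplane set" where
  "Gamma0_orbit p x = (\<lambda>A. moebius A x) ` Gamma0 p"

definition X0 :: "nat \<Rightarrow> cplane set set" where
  "X0 p = Gamma0_orbit p ` extended_upper_half_plane"

definition omega :: "nat \<Rightarrow> int^2^2" where
  "omega p = vector [vector [0, 1], vector [- int p, 0]]"

text \<open>Since \<open>omega p\<close> normalises \<open>\<Gamma>\<^sub>0(p)\<close>, it maps each orbit onto an orbit,
  so the induced map on \<open>X0 p\<close> is the direct image.\<close>

definition omega_tilde :: "nat \<Rightarrow> cplane set \<Rightarrow> cplane set" where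
  "omega_tilde p P = moebius (omega p) ` P"

definition ramification_points :: "nat \<Rightarrow> cplane set set" where
  "ramification_points p = {P \<in> X0 p. omega_tilde p P = P}"

text \<open>\<open>csqrt (- of_nat p)\<close> is the root \<open>\<i> * sqrt p\<close> in the upper half-plane.\<close>

definition K_field :: "nat \<Rightarrow> complex set" where
  "K_field p = {a + b * csqrt (- of_nat p) | a b. a \<in> \<rat> \<and> b \<in> \<rat>}"

definition zspan2 :: "complex \<Rightarrow> complex \<Rightarrow> complex set" where
  "zspan2 x y = {of_int m * x + of_int n * y | m n. True}"

definition beta :: "nat \<Rightarrow> complex" where
  "beta p = (if p mod 4 = 1 then csqrt (- of_nat p) else (1 + csqrt (- of_nat p)) / 2)"

definition max_order :: "nat \<Rightarrow> complex set" where
  "max_order p = zspan2 1 (beta p)"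

definition order2 :: "nat \<Rightarrow> complex set" where
  "order2 p = zspan2 1 (2 * beta p)"

definition K_lattice :: "nat \<Rightarrow> complex set \<Rightarrow> bool" where
  "K_lattice p L \<longleftrightarrow> (\<exists>x\<in>K_field p. \<exists>y\<in>K_field p. L = zspan2 x y \<and>
     (\<forall>m n :: int. of_int m * x + of_int n * y = 0 \<longrightarrow> m = 0 \<and> n = 0))"

definition proper_ideal :: "nat \<Rightarrow> complex set \<Rightarrow> complex set \<Rightarrow> bool" where
  "proper_ideal p R L \<longleftrightarrow> K_lattice p L \<and> {x \<in> K_field p. (\<lambda>y. x * y) ` L \<subseteq> L} = R"

definition ideal_group :: "nat \<Rightarrow> complex set \<Rightarrow> complex set monoid" where
  "ideal_group p R = \<lparr>carrier = {L. proper_ideal p R L},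
     mult = (\<lambda>A B. group_closure {a * b | a b. a \<in> A \<and> b \<in> B}), one = R\<rparr>"

definition principal_ideals :: "nat \<Rightarrow> complex set \<Rightarrow> complex set set" where
  "principal_ideals p R = {(\<lambda>x. z * x) ` R | z. z \<in> K_field p \<and> z \<noteq> 0}"

text \<open>Forming the coset of \<open>L\<close> modulo the principal ideals identifies \<open>L\<close> with all its
  multiples \<open>z L\<close>, \<open>z \<in> K\<^sup>*\<close>.\<close>

definition Cl :: "nat \<Rightarrow> complex set \<Rightarrow> complex set set monoid" where
  "Cl p R = ideal_group p R Mod principal_ideals p R"

definition ideal_class :: "nat \<Rightarrow> complex set \<Rightarrow> complex set \<Rightarrow> complex set set" where
  "ideal_class p R L = principal_ideals p R #>\<^bsub>ideal_group p R\<^esub> L"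

end

theory Submission
  imports Defs
begin

text \<open>
  Write \<open>s\<close> for \<open>\<surd>(-p)\<close>. A class \<open>[\<tau>]\<close> is fixed by the involution exactly when
  \<open>-1/(p\<tau>) = (a\<tau> + b)/(c\<tau> + d)\<close> for some matrix of \<open>\<Gamma>\<^sub>0(p)\<close>, that is, when \<open>\<tau>\<close> is a root of
  \<open>p a X\<^sup>2 + (p b + c) X + d\<close> (\<open>fixed_point_quadratic\<close>). Modulo \<open>p\<close> this form is \<open>d\<close> with \<open>d\<close> a
  unit, and a \<open>p\<close>-adic descent shows that it has no rational zero, so no cusp is fixed
  (\<open>no_rational_fixed_point\<close>).
  With \<open>c = p c'\<close> its discriminant is \<open>p\<^sup>2 (b - c')\<^sup>2 - 4 p\<close>. For \<open>\<tau>\<close> in the upper half-plane it is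
  negative, which leaves only \<open>-4p\<close>, and for \<open>p = 3\<close> also \<open>-3 = -p\<close> (\<open>fixed_point_discriminant\<close>).

  If \<open>\<tau>\<close> is a root of a primitive form \<open>A X\<^sup>2 + B X + C\<close>, the multipliers of the lattice
  \<open>[1, \<tau>]\<close> are \<open>[1, A \<tau>]\<close> (\<open>multipliers_primitive\<close>), and the discriminant identifies this ring:
  it is \<open>[1, s]\<close> for \<open>-4p\<close> and \<open>[1, (1 + s)/2]\<close> for \<open>-p\<close>. A form of discriminant \<open>-4p\<close> is
  primitive or twice a primitive form of discriminant \<open>-p\<close>; since discriminants are \<open>0\<close> or \<open>1\<close>
  modulo \<open>4\<close>, the second possibility forces \<open>p \<equiv> 3\<close> modulo \<open>4\<close> (\<open>lattice_order_dichotomy\<close>).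

  Finally \<open>[1, (a\<tau> + b)/(c\<tau> + d)] = (c\<tau> + d)\<^sup>-\<^sup>1 [1, \<tau>]\<close> for unimodular matrices
  (\<open>zspan2_moebius\<close>), and neither the ring of multipliers nor the ideal class changes under
  multiplication by an element of \<open>K\<^sup>*\<close>; hence both depend on \<open>[\<tau>]\<close> only.
\<close>

section \<open>The field generated by a square root of \<open>-p\<close>\<close>

lemma csqrt_minus_nat: "csqrt (- of_nat p) = \<i> * of_real (sqrt (real p))"
proof -
  show ?thesis using csqrt_of_real_nonpos[of "- of_nat p"] by simp
qed

text \<open>With \<open>s\<close> expanded to \<open>\<i> \<surd>p\<close>, rewriting would no longer recognise the coordinates
  \<open>a + b s\<close>; so \<open>s\<close> is treated as an opaque square root of \<open>-p\<close>.\<close>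

declare csqrt_minus [simp del] csqrt_of_real_nonpos [simp del]

lemma csqrt_minus_nat_square: "csqrt (- of_nat p) * csqrt (- of_nat p) = - of_nat p"
  by (metis power2_csqrt power2_eq_square)

lemma K_fieldI: "a \<in> \<rat> \<Longrightarrow> b \<in> \<rat> \<Longrightarrow> a + b * csqrt (- of_nat p) \<in> K_field p"
  unfolding K_field_def by blast

lemma Rats_K_field: "a \<in> \<rat> \<Longrightarrow> a \<in> K_field p"
  using K_fieldI[of a 0 p] by simp

lemma K_field_add:
  assumes "x \<in> K_field p" "y \<in> K_field p" shows "x + y \<in> K_field p"
proof -
  obtain a b c d where "a \<in> \<rat>" "b \<in> \<rat>" "c \<in> \<rat>" "d \<in> \<rat>"
    and xy: "x = a + b * csqrt (- of_nat p)" "y = c + d * csqrt (- of_nat p)"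
    using assms unfolding K_field_def by blast
  then have "(a + c) + (b + d) * csqrt (- of_nat p) \<in> K_field p"
    by (intro K_fieldI) auto
  then show ?thesis by (simp add: xy algebra_simps)
qed

lemma K_field_mult:
  assumes "x \<in> K_field p" "y \<in> K_field p" shows "x * y \<in> K_field p"
proof -
  obtain a b c d where "a \<in> \<rat>" "b \<in> \<rat>" "c \<in> \<rat>" "d \<in> \<rat>"
    and xy: "x = a + b * csqrt (- of_nat p)" "y = c + d * csqrt (- of_nat p)"
    using assms unfolding K_field_def by blast
  then have "(a * c - b * d * of_nat p) + (a * d + b * c) * csqrt (- of_nat p) \<in> K_field p"
    by (intro K_fieldI) auto
  moreover have "x * y = a * c + b * d * (csqrt (- of_nat p) * csqrt (- of_nat p))
      + (a * d + b * c) * csqrt (- of_nat p)"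
    by (simp add: xy algebra_simps)
  moreover have "a * c + b * d * - of_nat p = a * c - b * d * of_nat p" by simp
  ultimately show ?thesis unfolding csqrt_minus_nat_square by metis
qed

lemma cnj_Rats: "a \<in> \<rat> \<Longrightarrow> cnj a = a"
  by (elim Rats_cases') simp

lemma K_field_inverse:
  assumes "x \<in> K_field p" shows "inverse x \<in> K_field p"
proof (cases "x = 0")
  case False
  obtain a b where ab: "a \<in> \<rat>" "b \<in> \<rat>" and x: "x = a + b * csqrt (- of_nat p)"
    using assms unfolding K_field_def by blast
  have cnj: "cnj x = a - b * csqrt (- of_nat p)"
    using ab by (simp add: x csqrt_minus_nat cnj_Rats)
  have "x * cnj x = a * a - b * b * (csqrt (- of_nat p) * csqrt (- of_nat p))"
    unfolding cnj by (simp add: x algebra_simps)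
  then have norm: "x * cnj x = a * a + b * b * of_nat p"
    unfolding csqrt_minus_nat_square by simp
  then have "inverse (x * cnj x) \<in> K_field p"
    using ab by (intro Rats_K_field) auto
  moreover have "a + (- b) * csqrt (- of_nat p) \<in> K_field p"
    using ab by (intro K_fieldI) auto
  then have "cnj x \<in> K_field p" by (simp add: cnj)
  ultimately have "inverse (x * cnj x) * cnj x \<in> K_field p" by (rule K_field_mult)
  then show ?thesis using False by (simp add: field_simps)
qed (simp add: Rats_K_field)

lemmas K_field_closed = K_field_add K_field_mult K_field_inverse


section \<open>Lattices and their rings of multipliers\<close>

lemma zspan2_iff: "x \<in> zspan2 u v \<longleftrightarrow> (\<exists>m n. x = of_int m * u + of_int n * v)"
  unfolding zspan2_def by auto

lemma zspan2_1_translate: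
  fixes e :: int
  assumes "e = 1 \<or> e = - 1"
  shows "zspan2 1 (of_int k + of_int e * y) = zspan2 1 y"
proof (intro equalityI subsetI)
  fix x assume "x \<in> zspan2 1 (of_int k + of_int e * y)"
  then obtain m n where "x = of_int m * 1 + of_int n * (of_int k + of_int e * y)"
    unfolding zspan2_iff by blast
  then have "x = of_int (m + n * k) * 1 + of_int (n * e) * y" by (simp add: algebra_simps)
  then show "x \<in> zspan2 1 y" unfolding zspan2_iff by blast
next
  fix x assume "x \<in> zspan2 1 y"
  then obtain m n where "x = of_int m * 1 + of_int n * y" unfolding zspan2_iff by blast
  then have "x = of_int (m - n * e * k) * 1 + of_int (n * e) * (of_int k + of_int e * y)"
    using assms by (auto simp: algebra_simps)
  then show "x \<in> zspan2 1 (of_int k + of_int e * y)" unfolding zspan2_iff by blast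
qed

lemma independent_1_nonreal:
  assumes "Im z \<noteq> 0" and "of_int m + of_int n * z = 0"
  shows "m = 0 \<and> n = 0"
proof -
  have "of_int n * Im z = 0" using arg_cong[OF assms(2), of Im] by simp
  then have "n = 0" using assms(1) by simp
  then show ?thesis using assms(2) by simp
qed

lemma K_lattice_1_nonreal:
  assumes "z \<in> K_field p" and "Im z \<noteq> 0"
  shows "K_lattice p (zspan2 1 z)"
  unfolding K_lattice_def
proof (intro bexI conjI allI impI)
  fix m n :: int assume "of_int m * 1 + of_int n * z = 0"
  then show "m = 0" "n = 0" using independent_1_nonreal[OF assms(2), of m n] by auto
qed (use assms in \<open>auto intro: Rats_K_field\<close>)

lemma dvd_of_dvd_primitive:
  fixes A B C n :: int
  assumes prim: "\<And>g. g dvd A \<Longrightarrow> g dvd B \<Longrightarrow> g dvd C \<Longrightarrow> is_unit g"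
    and "A dvd n * B" "A dvd n * C"
  shows "A dvd n"
proof -
  have "is_unit (gcd A (gcd B C))"
    by (rule prim) (meson gcd_dvd1 gcd_dvd2 dvd_trans)+
  then have "gcd A (gcd B C) = 1"
    using abs_gcd_int by (metis zdvd1_eq)
  then have "coprime A (gcd B C)" by (simp add: coprime_iff_gcd_eq_1)
  moreover have "A dvd n * gcd B C"
    using assms(2,3) gcd_mult_distrib_int[of n B C] by (metis abs_dvd_iff dvd_abs_iff abs_mult abs_gcd_int gcd_greatest)
  ultimately show ?thesis by (simp add: coprime_dvd_mult_left_iff)
qed

text \<open>The inclusion \<open>x [1, \<tau>] \<subseteq> [1, \<tau>]\<close> forces \<open>x = m + n \<tau>\<close>, and then
  \<open>A x \<tau> = (A m - n B) \<tau> - n C\<close>. Comparing coordinates, \<open>A\<close> divides \<open>n B\<close> and \<open>n C\<close>, hence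
  \<open>n\<close> by primitivity.\<close>

lemma multipliers_primitive:
  fixes A B C :: int
  assumes root: "of_int A * \<tau>^2 + of_int B * \<tau> + of_int C = 0"
    and im: "Im \<tau> \<noteq> 0" and K: "\<tau> \<in> K_field p"
    and prim: "\<And>g. g dvd A \<Longrightarrow> g dvd B \<Longrightarrow> g dvd C \<Longrightarrow> is_unit g"
  shows "{x \<in> K_field p. (\<lambda>y. x * y) ` zspan2 1 \<tau> \<subseteq> zspan2 1 \<tau>} = zspan2 1 (of_int A * \<tau>)"
proof (intro equalityI subsetI)
  fix x assume "x \<in> {x \<in> K_field p. (\<lambda>y. x * y) ` zspan2 1 \<tau> \<subseteq> zspan2 1 \<tau>}"
  then have sub: "\<And>y. y \<in> zspan2 1 \<tau> \<Longrightarrow> x * y \<in> zspan2 1 \<tau>" by blast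
  have "1 = of_int 1 * 1 + of_int 0 * \<tau>" "\<tau> = of_int 0 * 1 + of_int 1 * \<tau>" by simp_all
  then have "1 \<in> zspan2 1 \<tau>" "\<tau> \<in> zspan2 1 \<tau>" unfolding zspan2_iff by blast+
  then have "x \<in> zspan2 1 \<tau>" "x * \<tau> \<in> zspan2 1 \<tau>" using sub by fastforce+
  then obtain m n k l where x: "x = of_int m + of_int n * \<tau>"
    and xt: "x * \<tau> = of_int k + of_int l * \<tau>"
    unfolding zspan2_iff by auto
  have "of_int (A * k + n * C) + of_int (A * l - A * m + n * B) * \<tau>
      = of_int A * (of_int k + of_int l * \<tau> - (of_int m + of_int n * \<tau>) * \<tau>)
        + of_int n * (of_int A * \<tau>^2 + of_int B * \<tau> + of_int C)"
    by (simp add: algebra_simps power2_eq_square)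
  also have "\<dots> = 0" using xt x root by simp
  finally have "A * k + n * C = 0" "A * l - A * m + n * B = 0"
    using independent_1_nonreal[OF im] by blast+
  then have "n * C = A * (- k)" "n * B = A * (m - l)" by (simp_all add: algebra_simps)
  then have "A dvd n * C" "A dvd n * B" by simp_all
  then have "A dvd n" using dvd_of_dvd_primitive[of A B C n] prim by blast
  then obtain j where "n = A * j" ..
  then have "x = of_int m * 1 + of_int j * (of_int A * \<tau>)" using x by simp
  then show "x \<in> zspan2 1 (of_int A * \<tau>)" unfolding zspan2_iff by blast
next
  fix x assume "x \<in> zspan2 1 (of_int A * \<tau>)"
  then obtain m n where x: "x = of_int m + of_int n * (of_int A * \<tau>)"
    unfolding zspan2_iff by auto
  have "x \<in> K_field p" unfolding x by (intro K_field_closed K Rats_K_field) auto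
  moreover have "x * y \<in> zspan2 1 \<tau>" if "y \<in> zspan2 1 \<tau>" for y
  proof -
    obtain k l where y: "y = of_int k + of_int l * \<tau>" using \<open>y \<in> zspan2 1 \<tau>\<close> unfolding zspan2_iff by auto
    have "x * y = of_int (m * k - n * l * C) * 1 + of_int (m * l + n * A * k - n * l * B) * \<tau>
      + of_int (n * l) * (of_int A * \<tau>^2 + of_int B * \<tau> + of_int C)"
      by (simp add: x y algebra_simps power2_eq_square)
    also have "\<dots> = of_int (m * k - n * l * C) * 1 + of_int (m * l + n * A * k - n * l * B) * \<tau>"
      using root by simp
    finally show ?thesis unfolding zspan2_iff by blast
  qed
  ultimately show "x \<in> {x \<in> K_field p. (\<lambda>y. x * y) ` zspan2 1 \<tau> \<subseteq> zspan2 1 \<tau>}" by auto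
qed

text \<open>The square of a common divisor of the coefficients divides the discriminant, and \<open>p\<close> is
  squarefree; an odd \<open>g\<close> does not see the factor \<open>4\<close>.\<close>

lemma prime_discriminant_primitive:
  fixes A B C g :: int
  assumes "prime p" and disc: "B^2 - 4 * A * C = - int p \<or> B^2 - 4 * A * C = - 4 * int p \<and> odd g"
    and "g dvd A" "g dvd B" "g dvd C"
  shows "is_unit g"
proof -
  have "g * g dvd B * B - 4 * (A * C)"
    using assms(3-5) by (intro dvd_diff mult_dvd_mono dvd_mult) auto
  then have d: "g * g dvd B^2 - 4 * A * C" by (simp add: power2_eq_square mult.assoc)
  have "g * g dvd int p"
    using disc
  proof
    assume "B^2 - 4 * A * C = - int p"
    with d show ?thesis by simp
  next
    assume h: "B^2 - 4 * A * C = - 4 * int p \<and> odd g"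
    then have "g * g dvd 2 * (2 * int p)" using d by simp
    moreover from h have "coprime (g * g) 2" by simp
    ultimately show ?thesis by (simp only: coprime_dvd_mult_right_iff)
  qed
  then obtain k where k: "int p = g * (g * k)" by (metis dvdE mult.assoc)
  have pr: "prime (int p)" using \<open>prime p\<close> by simp
  show ?thesis
  proof (rule ccontr)
    assume nu: "\<not> is_unit g"
    then have "is_unit (g * k)"
      using prime_elem_imp_irreducible[of "int p"] pr k irreducibleD by blast
    then show False using nu is_unit_mult_iff by blast
  qed
qed

lemma quadratic_root_cases:
  fixes A B C f :: int
  assumes root: "of_int A * \<tau>^2 + of_int B * \<tau> + of_int C = 0"
    and disc: "B^2 - 4 * A * C = - (f^2 * int p)"
  obtains e :: int where "e = 1 \<or> e = - 1"
    "2 * (of_int A * \<tau>) = - of_int B + of_int (e * f) * csqrt (- of_nat p)"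
proof -
  let ?s = "csqrt (- of_nat p)"
  have "(2 * (of_int A * \<tau>) + of_int B)^2
      = of_int (B^2 - 4 * A * C) + 4 * of_int A * (of_int A * \<tau>^2 + of_int B * \<tau> + of_int C)"
    by (simp add: algebra_simps power2_eq_square)
  also have "\<dots> = (of_int f * ?s)^2"
    unfolding root disc by (simp add: power_mult_distrib)
  finally have "2 * (of_int A * \<tau>) + of_int B = of_int f * ?s
      \<or> 2 * (of_int A * \<tau>) + of_int B = - (of_int f * ?s)"
    by (simp add: power2_eq_iff)
  then show ?thesis
  proof
    assume "2 * (of_int A * \<tau>) + of_int B = of_int f * ?s"
    then have "2 * (of_int A * \<tau>) = - of_int B + of_int (1 * f) * ?s" by (simp add: algebra_simps eq_diff_eq)
    then show ?thesis using that by blast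
  next
    assume "2 * (of_int A * \<tau>) + of_int B = - (of_int f * ?s)"
    then have "2 * (of_int A * \<tau>) = - (of_int f * ?s) - of_int B" by (simp only: eq_diff_eq)
    then have "2 * (of_int A * \<tau>) = - of_int B + of_int ((- 1) * f) * ?s"
      by simp
    then show ?thesis using that by blast
  qed
qed

lemma quadratic_root_in_K_field:
  fixes A B C f :: int
  assumes root: "of_int A * \<tau>^2 + of_int B * \<tau> + of_int C = 0" and "A \<noteq> 0"
    and disc: "B^2 - 4 * A * C = - (f^2 * int p)"
  shows "\<tau> \<in> K_field p"
proof -
  obtain e :: int where e: "2 * (of_int A * \<tau>) = - of_int B + of_int (e * f) * csqrt (- of_nat p)"
    using quadratic_root_cases[OF root disc] by blast
  have "- of_int B + of_int (e * f) * csqrt (- of_nat p) \<in> K_field p"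
    by (intro K_fieldI) auto
  then have "2 * (of_int A * \<tau>) \<in> K_field p" by (simp only: e)
  then have "inverse (2 * of_int A) * (2 * (of_int A * \<tau>)) \<in> K_field p"
    by (rule K_field_mult[OF Rats_K_field, rotated]) auto
  moreover have "inverse (2 * of_int A) * (2 * (of_int A * \<tau>)) = \<tau>"
    using \<open>A \<noteq> 0\<close> by (simp add: field_simps)
  ultimately show ?thesis by (simp only:)
qed

lemma proper_ideal_discriminant_4p:
  fixes A B C :: int
  assumes root: "of_int A * \<tau>^2 + of_int B * \<tau> + of_int C = 0"
    and im: "Im \<tau> \<noteq> 0" and "A \<noteq> 0"
    and disc: "B^2 - 4 * A * C = - 4 * int p"
    and prim: "\<And>g. g dvd A \<Longrightarrow> g dvd B \<Longrightarrow> g dvd C \<Longrightarrow> is_unit g"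
  shows "proper_ideal p (zspan2 1 (csqrt (- of_nat p))) (zspan2 1 \<tau>)"
proof -
  have disc': "B^2 - 4 * A * C = - (2^2 * int p)" using disc by simp
  have K: "\<tau> \<in> K_field p" by (rule quadratic_root_in_K_field[OF root \<open>A \<noteq> 0\<close> disc'])
  have "B^2 = 2 * (2 * A * C - 2 * int p)" using disc by simp
  then have "even (B^2)" by (metis dvd_triv_left)
  then have "even B" by simp
  then obtain b where b: "B = 2 * b" ..
  obtain e :: int where e: "e = 1 \<or> e = - 1"
    and h: "2 * (of_int A * \<tau>) = - of_int B + of_int (e * 2) * csqrt (- of_nat p)"
    by (rule quadratic_root_cases[OF root disc'])
  have "2 * (of_int A * \<tau>) = 2 * (of_int (- b) + of_int e * csqrt (- of_nat p))"
    using h by (simp add: b algebra_simps)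
  then have "of_int A * \<tau> = of_int (- b) + of_int e * csqrt (- of_nat p)"
    by (metis mult_left_cancel zero_neq_numeral)
  then have "zspan2 1 (of_int A * \<tau>) = zspan2 1 (csqrt (- of_nat p))"
    by (simp only: zspan2_1_translate[OF e])
  then show ?thesis
    using K_lattice_1_nonreal[OF K im] multipliers_primitive[OF root im K prim]
    by (simp add: proper_ideal_def)
qed

lemma proper_ideal_discriminant_p:
  fixes A B C :: int
  assumes root: "of_int A * \<tau>^2 + of_int B * \<tau> + of_int C = 0"
    and im: "Im \<tau> \<noteq> 0" and "A \<noteq> 0" and "odd p"
    and disc: "B^2 - 4 * A * C = - int p"
    and prim: "\<And>g. g dvd A \<Longrightarrow> g dvd B \<Longrightarrow> g dvd C \<Longrightarrow> is_unit g"
  shows "proper_ideal p (zspan2 1 ((1 + csqrt (- of_nat p)) / 2)) (zspan2 1 \<tau>)"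
    and "p mod 4 = 3"
proof -
  let ?w = "(1 + csqrt (- of_nat p)) / 2"
  have disc': "B^2 - 4 * A * C = - (1^2 * int p)" using disc by simp
  have K: "\<tau> \<in> K_field p" by (rule quadratic_root_in_K_field[OF root \<open>A \<noteq> 0\<close> disc'])
  have B2: "B^2 = 2 * (2 * A * C) - int p" using disc by simp
  have "odd (B^2)" unfolding B2 using \<open>odd p\<close> by simp
  then have "odd B" by simp
  then obtain b where b: "B = 2 * b + 1" by (elim oddE)
  have "int p = 4 * (A * C - b * b - b - 1) + 3"
    using disc by (simp add: b power2_eq_square algebra_simps)
  then have "int p mod 4 = 3" by presburger
  then show "p mod 4 = 3" by presburger
  obtain e :: int where e: "e = 1 \<or> e = - 1"
    and h: "2 * (of_int A * \<tau>) = - of_int B + of_int (e * 1) * csqrt (- of_nat p)"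
    by (rule quadratic_root_cases[OF root disc'])
  have "zspan2 1 (of_int A * \<tau>) = zspan2 1 ?w"
    using e
  proof
    assume "e = 1"
    then have "of_int A * \<tau> = of_int (- b - 1) + of_int 1 * ?w"
      using h by (simp add: b field_simps)
    then show ?thesis by (simp only: zspan2_1_translate simp_thms)
  next
    assume "e = - 1"
    then have "of_int A * \<tau> = of_int (- b) + of_int (- 1) * ?w"
      using h by (simp add: b field_simps)
    then show ?thesis by (simp only: zspan2_1_translate simp_thms)
  qed
  then show "proper_ideal p (zspan2 1 ?w) (zspan2 1 \<tau>)"
    using K_lattice_1_nonreal[OF K im] multipliers_primitive[OF root im K prim]
    by (simp add: proper_ideal_def)
qed

lemma lattice_order_dichotomy:
  fixes A B C :: int
  assumes p: "prime p" "odd p"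
    and root: "of_int A * \<tau>^2 + of_int B * \<tau> + of_int C = 0"
    and im: "Im \<tau> \<noteq> 0"
    and disc: "B^2 - 4 * A * C = - int p \<or> B^2 - 4 * A * C = - 4 * int p"
  shows "proper_ideal p (zspan2 1 (csqrt (- of_nat p))) (zspan2 1 \<tau>)
    \<or> p mod 4 = 3 \<and> proper_ideal p (zspan2 1 ((1 + csqrt (- of_nat p)) / 2)) (zspan2 1 \<tau>)"
proof -
  have "p > 0" using p(1) by (rule prime_gt_0_nat)
  have "A \<noteq> 0"
  proof
    assume "A = 0"
    then have "B^2 = - int p \<or> B^2 = - 4 * int p" using disc by simp
    then show False using zero_le_power2[of B] \<open>p > 0\<close> by linarith
  qed
  consider (p) "B^2 - 4 * A * C = - int p"
    | (even) "B^2 - 4 * A * C = - 4 * int p" "even A" "even B" "even C"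
    | (prim) "B^2 - 4 * A * C = - 4 * int p" "\<not> (even A \<and> even B \<and> even C)"
    using disc by blast
  then show ?thesis
  proof cases
    case p
    have "is_unit g" if "g dvd A" "g dvd B" "g dvd C" for g
      using prime_discriminant_primitive[OF assms(1) _ that] p by blast
    then show ?thesis
      using proper_ideal_discriminant_p[OF root im \<open>A \<noteq> 0\<close> assms(2) p] by blast
  next
    case even
    then obtain A' B' C' where half: "A = 2 * A'" "B = 2 * B'" "C = 2 * C'" by (elim dvdE)
    have disc': "B'^2 - 4 * A' * C' = - int p"
      using even(1) by (simp add: half power2_eq_square)
    have "2 * (of_int A' * \<tau>^2 + of_int B' * \<tau> + of_int C') = 0"
      using root by (simp add: half algebra_simps)
    then have root': "of_int A' * \<tau>^2 + of_int B' * \<tau> + of_int C' = 0"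
      by (simp only: mult_eq_0_iff) simp
    have "is_unit g" if "g dvd A'" "g dvd B'" "g dvd C'" for g
      using prime_discriminant_primitive[OF p(1) _ that] disc' by blast
    moreover have "A' \<noteq> 0" using \<open>A \<noteq> 0\<close> half by simp
    ultimately show ?thesis
      using proper_ideal_discriminant_p[OF root' im _ p(2) disc'] by blast
  next
    case prim
    have "is_unit g" if g: "g dvd A" "g dvd B" "g dvd C" for g
    proof -
      have "odd g" using prim(2) g by (meson dvd_trans)
      then show ?thesis using prime_discriminant_primitive[OF p(1) _ g] prim(1) by blast
    qed
    then show ?thesis
      using proper_ideal_discriminant_4p[OF root im \<open>A \<noteq> 0\<close> prim(1)] by blast
  qed
qed


section \<open>Fixed points of the involution\<close>

lemma fixed_point_quadratic:
  assumes "p > 0" and "moebius (omega p) (Fin z) = moebius A (Fin z)"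
  shows "of_int (int p * A$1$1) * z^2 + of_int (int p * A$1$2 + A$2$1) * z + of_int (A$2$2) = 0"
proof (cases "z = 0")
  case True
  \<comment> \<open>The involution sends \<open>0\<close> to the cusp at infinity, so \<open>A\<close> must do so as well: its lower
    right entry vanishes, which is the equation at \<open>z = 0\<close>.\<close>
  then show ?thesis using assms by (auto simp: omega_def split: if_splits)
next
  case False
  then have den: "of_int (A$2$1) * z + of_int (A$2$2) \<noteq> 0"
    and eq: "1 / (- of_nat p * z)
      = (of_int (A$1$1) * z + of_int (A$1$2)) / (of_int (A$2$1) * z + of_int (A$2$2))"
    using assms by (auto simp: omega_def split: if_splits)
  have nz: "- of_nat p * z \<noteq> 0" using False \<open>p > 0\<close> by simp
  have "of_int (A$2$1) * z + of_int (A$2$2)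
      = (of_int (A$1$1) * z + of_int (A$1$2)) * (- of_nat p * z)"
    using eq unfolding frac_eq_eq[OF nz den] by (simp only: mult_1_left)
  then have "(of_int (A$2$1) * z + of_int (A$2$2))
      - (of_int (A$1$1) * z + of_int (A$1$2)) * (- of_nat p * z) = 0" by simp
  then show ?thesis by (simp add: algebra_simps power2_eq_square)
qed

lemma Gamma0_entries:
  assumes "A \<in> Gamma0 p"
  obtains c where "A$2$1 = int p * c" "A$1$1 * A$2$2 = 1 + int p * (A$1$2 * c)"
proof -
  obtain c where c: "A$2$1 = int p * c" using assms by (auto simp: Gamma0_def)
  have "A$1$1 * A$2$2 - A$1$2 * A$2$1 = 1" using assms by (simp add: Gamma0_def det_2)
  then have "A$1$1 * A$2$2 = 1 + int p * (A$1$2 * c)" by (simp add: c algebra_simps)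
  with c show ?thesis by (rule that)
qed

lemma prime_not_dvd_diagonal:
  assumes "prime p" and ad: "a * d = 1 + int p * k"
  shows "\<not> int p dvd a" "\<not> int p dvd d"
proof -
  have "\<not> int p dvd a * d"
  proof
    assume "int p dvd a * d"
    then have "int p dvd 1" using ad by (metis dvd_add_left_iff dvd_triv_left)
    then show False using \<open>prime p\<close> by (simp add: prime_nat_iff)
  qed
  then show "\<not> int p dvd a" "\<not> int p dvd d" by auto
qed

text \<open>Descent: \<open>a\<close> and \<open>d\<close> are units modulo \<open>p\<close>. Reducing the equation modulo \<open>p\<close> gives
  \<open>p | v\<close>; after division by \<open>p\<close> the same argument gives \<open>p | u\<close>.\<close>

lemma no_rational_fixed_point:
  fixes a b c d u v :: int
  assumes "prime p" and ad: "a * d = 1 + int p * (b * c)" and "coprime u v"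
    and eq: "int p * a * u^2 + (int p * b + int p * c) * (u * v) + d * v^2 = 0"
  shows False
proof -
  have pr: "prime (int p)" using \<open>prime p\<close> by simp
  then have p0: "int p \<noteq> 0" by auto
  note nd = prime_not_dvd_diagonal[OF \<open>prime p\<close> ad]
  have "d * v^2 = int p * (- (a * u^2 + (b + c) * (u * v)))"
    using eq by (simp add: algebra_simps)
  then have "int p dvd d * v^2" by (metis dvd_triv_left)
  then have pv: "int p dvd v" using nd(2) pr by (meson prime_dvd_mult_iff prime_dvd_power)
  then obtain w where w: "v = int p * w" ..
  have "int p * (a * u^2 + int p * ((b + c) * (u * w) + d * w^2)) = 0"
    using eq by (simp add: w algebra_simps power2_eq_square)
  then have "a * u^2 + int p * ((b + c) * (u * w) + d * w^2) = 0" using p0 by simp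
  then have "a * u^2 = int p * (- ((b + c) * (u * w) + d * w^2))" by (simp add: algebra_simps)
  then have "int p dvd a * u^2" by (metis dvd_triv_left)
  then have "int p dvd u" using nd(1) pr by (meson prime_dvd_mult_iff prime_dvd_power)
  then have "is_unit (int p)" using coprime_common_divisor[OF \<open>coprime u v\<close> _ pv] by blast
  then show False using \<open>prime p\<close> by (auto simp: prime_nat_iff)
qed

lemma cusp_not_fixed:
  assumes "prime p" and A: "A \<in> Gamma0 p" and "x = Infty \<or> x \<in> Fin ` \<rat>"
  shows "moebius (omega p) x \<noteq> moebius A x"
proof
  assume fixp: "moebius (omega p) x = moebius A x"
  have "p > 0" using \<open>prime p\<close> by (rule prime_gt_0_nat)
  obtain c where c: "A$2$1 = int p * c"
    and ad: "A$1$1 * A$2$2 = 1 + int p * (A$1$2 * c)"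
    using Gamma0_entries[OF A] by blast
  from assms(3) show False
  proof
    assume "x = Infty"
    then have "A$1$1 = 0"
      using fixp \<open>p > 0\<close> by (auto simp: omega_def split: if_splits)
    then show False using prime_not_dvd_diagonal(1)[OF \<open>prime p\<close> ad] by simp
  next
    assume "x \<in> Fin ` \<rat>"
    then obtain z where x: "x = Fin z" and "z \<in> \<rat>" by blast
    from \<open>z \<in> \<rat>\<close> obtain u v :: int where uv: "v > 0" "coprime u v" "z = of_int u / of_int v"
      by (elim Rats_cases')
    have q: "of_int (int p * A$1$1) * z^2 + of_int (int p * A$1$2 + A$2$1) * z + of_int (A$2$2) = 0"
      using fixed_point_quadratic[OF \<open>p > 0\<close>] fixp x by blast
    have "(of_int (int p * A$1$1 * u^2 + (int p * A$1$2 + int p * c) * (u * v) + A$2$2 * v^2) :: complex)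
        = of_int v ^ 2 * (of_int (int p * A$1$1) * z^2 + of_int (int p * A$1$2 + A$2$1) * z + of_int (A$2$2))"
      using uv(1) by (simp add: uv(3) c field_simps power2_eq_square)
    then have "int p * A$1$1 * u^2 + (int p * A$1$2 + int p * c) * (u * v) + A$2$2 * v^2 = 0"
      unfolding q by (simp only: mult_zero_right of_int_eq_0_iff)
    then show False by (rule no_rational_fixed_point[OF \<open>prime p\<close> ad uv(2)])
  qed
qed

text \<open>A nonreal number with real square is purely imaginary; this applies to \<open>2 A \<tau> + B\<close>,
  whose square is the discriminant.\<close>

lemma nonreal_root_discriminant_neg:
  fixes A B C :: int
  assumes root: "of_int A * \<tau>^2 + of_int B * \<tau> + of_int C = 0"
    and im: "Im \<tau> \<noteq> 0" and "A \<noteq> 0"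
  shows "B^2 - 4 * A * C < 0"
proof -
  let ?z = "2 * (of_int A * \<tau>) + of_int B"
  have "?z^2 = of_int (B^2 - 4 * A * C) + 4 * of_int A * (of_int A * \<tau>^2 + of_int B * \<tau> + of_int C)"
    by (simp add: algebra_simps power2_eq_square)
  then have z: "?z^2 = of_int (B^2 - 4 * A * C)" unfolding root by simp
  have im': "Im ?z \<noteq> 0" using im \<open>A \<noteq> 0\<close> by simp
  have "2 * Re ?z * Im ?z = 0"
    using arg_cong[OF z, of Im] by (simp only: Im_power2 complex_Im_of_int)
  then have re0: "Re ?z = 0" using im' by (simp only: mult_eq_0_iff) simp
  have "(Re ?z)^2 - (Im ?z)^2 = of_int (B^2 - 4 * A * C)"
    using arg_cong[OF z, of Re] by (simp only: Re_power2 complex_Re_of_int)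
  then have "- ((Im ?z)^2) = of_int (B^2 - 4 * A * C)" unfolding re0 by simp
  moreover have "(Im ?z)^2 > 0" using im' by simp
  ultimately have "(of_int (B^2 - 4 * A * C) :: real) < 0" by linarith
  then show ?thesis by (simp only: of_int_less_0_iff)
qed

text \<open>If the off-diagonal entries of the matrix are \<open>b\<close> and \<open>p c\<close>, the discriminant of the form
  in \<open>fixed_point_quadratic\<close> is \<open>p\<^sup>2 k\<^sup>2 - 4 p\<close> with \<open>k = b - c\<close>; negativity means \<open>p k\<^sup>2 < 4\<close>, so
  \<open>k = 0\<close>, or \<open>p = 3\<close> and \<open>k = \<plusminus>1\<close>.\<close>

lemma fixed_point_discriminant:
  assumes p: "prime p" "odd p" and A: "A \<in> Gamma0 p" and im: "Im \<tau> \<noteq> 0"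
    and fixp: "moebius (omega p) (Fin \<tau>) = moebius A (Fin \<tau>)"
  obtains a b c :: int where "of_int a * \<tau>^2 + of_int b * \<tau> + of_int c = 0"
    "b^2 - 4 * a * c = - int p \<or> b^2 - 4 * a * c = - 4 * int p"
proof -
  have "p > 0" using p(1) by (rule prime_gt_0_nat)
  obtain c where c: "A$2$1 = int p * c"
    and ad: "A$1$1 * A$2$2 = 1 + int p * (A$1$2 * c)"
    using Gamma0_entries[OF A] by blast
  let ?B = "int p * A$1$2 + A$2$1"
  define k where "k = A$1$2 - c"
  have root: "of_int (int p * A$1$1) * \<tau>^2 + of_int ?B * \<tau> + of_int (A$2$2) = 0"
    using fixed_point_quadratic[OF \<open>p > 0\<close> fixp] .
  have "?B^2 - 4 * (int p * A$1$1) * A$2$2 = ?B^2 - 4 * int p * (A$1$1 * A$2$2)" by simp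
  also have "\<dots> = int p * (int p * k^2 - 4)"
    unfolding ad by (simp add: c k_def algebra_simps power2_eq_square)
  finally have disc: "?B^2 - 4 * (int p * A$1$1) * A$2$2 = int p * (int p * k^2 - 4)" .
  have "A$1$1 \<noteq> 0" using prime_not_dvd_diagonal(1)[OF p(1) ad] by auto
  then have "int p * (int p * k^2 - 4) < 0"
    using nonreal_root_discriminant_neg[OF root im] \<open>p > 0\<close> disc by simp
  then have lt: "int p * k^2 < 4" using \<open>p > 0\<close> by (simp add: mult_less_0_iff)
  have p3: "int p \<ge> 3"
    using prime_ge_2_nat[OF p(1)] p(2) by (cases "p = 2") auto
  have "int p * (int p * k^2 - 4) = - int p \<or> int p * (int p * k^2 - 4) = - 4 * int p"
  proof (cases "k = 0")
    case False
    then have k1: "k^2 \<ge> 1" by (simp add: int_one_le_iff_zero_less)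
    then have "int p * 1 \<le> int p * k^2" by (intro mult_left_mono) auto
    then have "int p = 3" using lt p3 by linarith
    then have "k^2 = 1" using lt k1 by simp
    then show ?thesis using \<open>int p = 3\<close> by simp
  qed simp
  with disc have "?B^2 - 4 * (int p * A$1$1) * A$2$2 = - int p
      \<or> ?B^2 - 4 * (int p * A$1$1) * A$2$2 = - 4 * int p" by simp
  with root show ?thesis by (rule that)
qed

lemma mem_Gamma0_orbit: "x \<in> Gamma0_orbit p x"
proof -
  have "(mat 1 :: int^2^2) \<in> Gamma0 p" by (simp add: Gamma0_def det_2 mat_def)
  moreover have "moebius (mat 1) x = x" by (cases x) (simp_all add: mat_def)
  ultimately show ?thesis unfolding Gamma0_orbit_def by force
qed

lemma ramification_point_fixed:
  assumes "Gamma0_orbit p x \<in> ramification_points p"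
  obtains A where "A \<in> Gamma0 p" "moebius (omega p) x = moebius A x"
proof -
  have "moebius (omega p) x \<in> omega_tilde p (Gamma0_orbit p x)"
    unfolding omega_tilde_def using mem_Gamma0_orbit by blast
  then have "moebius (omega p) x \<in> Gamma0_orbit p x"
    using assms by (simp add: ramification_points_def)
  then show ?thesis using that unfolding Gamma0_orbit_def by blast
qed

lemma ramification_point_not_cusp:
  assumes "prime p" and P: "P \<in> ramification_points p"
  shows "\<exists>\<tau>\<in>upper_half_plane. P = Gamma0_orbit p (Fin \<tau>)"
proof -
  obtain x where x: "x \<in> extended_upper_half_plane" and Px: "P = Gamma0_orbit p x"
    using P unfolding ramification_points_def X0_def by blast
  obtain A where "A \<in> Gamma0 p" "moebius (omega p) x = moebius A x"
    using ramification_point_fixed P Px by blast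
  then have "\<not> (x = Infty \<or> x \<in> Fin ` \<rat>)" using cusp_not_fixed[OF \<open>prime p\<close>] by blast
  then have "x \<in> Fin ` upper_half_plane" using x by (auto simp: extended_upper_half_plane_def)
  then show ?thesis using Px by blast
qed

lemma ramification_point_order:
  assumes "prime p" "odd p" and P: "Gamma0_orbit p (Fin \<tau>) \<in> ramification_points p"
    and \<tau>: "\<tau> \<in> upper_half_plane"
  shows "proper_ideal p (zspan2 1 (csqrt (- of_nat p))) (zspan2 1 \<tau>)
    \<or> p mod 4 = 3 \<and> proper_ideal p (zspan2 1 ((1 + csqrt (- of_nat p)) / 2)) (zspan2 1 \<tau>)"
proof -
  have im: "Im \<tau> \<noteq> 0" using \<tau> by (simp add: upper_half_plane_def)
  obtain A where "A \<in> Gamma0 p" "moebius (omega p) (Fin \<tau>) = moebius A (Fin \<tau>)"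
    using ramification_point_fixed[OF P] .
  then obtain a b c :: int where "of_int a * \<tau>^2 + of_int b * \<tau> + of_int c = 0"
    "b^2 - 4 * a * c = - int p \<or> b^2 - 4 * a * c = - 4 * int p"
    using fixed_point_discriminant[OF assms(1,2) _ im] by blast
  then show ?thesis by (rule lattice_order_dichotomy[OF assms(1,2) _ im])
qed


section \<open>Independence of the representative\<close>

lemma zspan2_moebius:
  assumes det: "det A = 1" and im: "Im \<tau> \<noteq> 0" and "moebius A (Fin \<tau>) = Fin \<sigma>"
  obtains w where "w = inverse (of_int (A$2$1) * \<tau> + of_int (A$2$2))" "w \<noteq> 0"
    "zspan2 1 \<sigma> = (\<lambda>x. w * x) ` zspan2 1 \<tau>"
proof -
  let ?a = "A$1$1" and ?b = "A$1$2" and ?c = "A$2$1" and ?d = "A$2$2"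
  let ?q = "of_int ?c * \<tau> + of_int ?d"
  have q: "?q \<noteq> 0" and \<sigma>: "\<sigma> = (of_int ?a * \<tau> + of_int ?b) / ?q"
    using assms(3) by (auto split: if_splits)
  have dt: "?a * ?d - ?b * ?c = 1" using det by (simp add: det_2)
  have "zspan2 1 \<sigma> = (\<lambda>x. inverse ?q * x) ` zspan2 1 \<tau>"
  proof (intro equalityI subsetI)
    fix x assume "x \<in> zspan2 1 \<sigma>"
    then obtain m n where "x = of_int m * 1 + of_int n * \<sigma>" unfolding zspan2_iff by blast
    then have "x = inverse ?q * (of_int (m * ?d + n * ?b) * 1 + of_int (m * ?c + n * ?a) * \<tau>)"
      using q by (simp add: \<sigma> field_simps)
    then show "x \<in> (\<lambda>x. inverse ?q * x) ` zspan2 1 \<tau>" unfolding image_iff Bex_def zspan2_iff by blast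
  next
    fix x assume "x \<in> (\<lambda>x. inverse ?q * x) ` zspan2 1 \<tau>"
    then obtain m n where x: "x = inverse ?q * (of_int m + of_int n * \<tau>)"
      unfolding zspan2_def by auto
    \<comment> \<open>The inverse matrix sends the coordinates of \<open>m + n \<tau>\<close> to those with respect to
      \<open>c \<tau> + d\<close> and \<open>a \<tau> + b\<close>.\<close>
    let ?k = "m * ?a - n * ?b" and ?l = "n * ?d - m * ?c"
    have "of_int m + of_int n * \<tau> = of_int (m * (?a * ?d - ?b * ?c)) + of_int (n * (?a * ?d - ?b * ?c)) * \<tau>"
      unfolding dt by simp
    also have "\<dots> = of_int ?k * ?q + of_int ?l * (of_int ?a * \<tau> + of_int ?b)"
      by (simp add: algebra_simps)
    finally have "x = of_int ?k * 1 + of_int ?l * \<sigma>"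
      unfolding x using q by (simp add: \<sigma> field_simps del: of_int_diff of_int_mult)
    then show "x \<in> zspan2 1 \<sigma>" unfolding zspan2_iff by blast
  qed
  then show ?thesis using that q by simp
qed

lemma multipliers_scale:
  fixes L :: "complex set"
  assumes "w \<noteq> 0"
  shows "(\<lambda>y. x * y) ` (\<lambda>y. w * y) ` L \<subseteq> (\<lambda>y. w * y) ` L \<longleftrightarrow> (\<lambda>y. x * y) ` L \<subseteq> L"
proof -
  have "(\<lambda>y. x * y) ` (\<lambda>y. w * y) ` L = (\<lambda>y. w * y) ` (\<lambda>y. x * y) ` L"
    by (simp add: image_image mult.left_commute)
  moreover have "inj (\<lambda>y. w * y)" using assms by (auto intro: injI)
  ultimately show ?thesis by (simp add: inj_image_subset_iff)
qed

text \<open>A factor \<open>w\<close> can be moved from \<open>L\<close> to the principal ideal \<open>z R\<close> without changing the set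
  of products, and \<open>z w\<close> runs through \<open>K\<^sup>*\<close> together with \<open>z\<close>.\<close>

lemma ideal_class_scale:
  assumes w: "w \<in> K_field p" "w \<noteq> 0"
  shows "ideal_class p R ((\<lambda>x. w * x) ` L) = ideal_class p R L"
proof -
  have move: "(\<lambda>x. z * x) ` R \<otimes>\<^bsub>ideal_group p R\<^esub> (\<lambda>x. w * x) ` L
      = (\<lambda>x. (z * w) * x) ` R \<otimes>\<^bsub>ideal_group p R\<^esub> L" for z
  proof -
    have "{a * b |a b. a \<in> (\<lambda>x. z * x) ` R \<and> b \<in> (\<lambda>x. w * x) ` L}
        = {(z * r) * (w * l) |r l. r \<in> R \<and> l \<in> L}" by blast
    also have "\<dots> = {((z * w) * r) * l |r l. r \<in> R \<and> l \<in> L}" by (simp add: mult_ac)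
    also have "\<dots> = {a * b |a b. a \<in> (\<lambda>x. (z * w) * x) ` R \<and> b \<in> L}" by blast
    finally show ?thesis by (simp add: ideal_group_def)
  qed
  have cls: "ideal_class p R M
      = (\<lambda>z. (\<lambda>x. z * x) ` R \<otimes>\<^bsub>ideal_group p R\<^esub> M) ` (K_field p - {0})" for M
    unfolding ideal_class_def r_coset_def principal_ideals_def by blast
  have "(\<lambda>z. z * w) ` (K_field p - {0}) = K_field p - {0}"
  proof (intro equalityI subsetI)
    fix z assume z: "z \<in> K_field p - {0}"
    then have "z * inverse w \<in> K_field p - {0}" using w by (auto intro: K_field_closed)
    moreover have "z = (z * inverse w) * w" using w by simp
    ultimately show "z \<in> (\<lambda>z. z * w) ` (K_field p - {0})" by blast
  qed (use w in \<open>auto intro: K_field_closed\<close>)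
  then have "ideal_class p R L = (\<lambda>z. (\<lambda>x. z * x) ` R \<otimes>\<^bsub>ideal_group p R\<^esub> L)
      ` (\<lambda>z. z * w) ` (K_field p - {0})"
    by (simp only: cls)
  also have "\<dots> = (\<lambda>z. (\<lambda>x. (z * w) * x) ` R \<otimes>\<^bsub>ideal_group p R\<^esub> L) ` (K_field p - {0})"
    by (simp only: image_image[of _ "\<lambda>z. z * w"])
  also have "\<dots> = ideal_class p R ((\<lambda>x. w * x) ` L)" by (simp only: cls move)
  finally show ?thesis ..
qed

lemma ideal_class_mem_Cl:
  "proper_ideal p R L \<Longrightarrow> ideal_class p R L \<in> carrier (Cl p R)"
  unfolding ideal_class_def Cl_def FactGroup_def RCOSETS_def by (auto simp: ideal_group_def)

text \<open>For \<open>\<sigma> = A \<tau>\<close> the lattices differ by the factor \<open>(c \<tau> + d)\<^sup>-\<^sup>1\<close>, which lies in \<open>K\<close>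
  because \<open>\<tau>\<close> does.\<close>

lemma orbit_ideal_class:
  assumes orb: "Gamma0_orbit p (Fin \<tau>) = Gamma0_orbit p (Fin \<sigma>)"
    and \<tau>: "\<tau> \<in> upper_half_plane" and K: "K_lattice p (zspan2 1 \<sigma>)"
    and ideal: "proper_ideal p R (zspan2 1 \<tau>)" and "\<tau> \<in> K_field p"
  shows "proper_ideal p R (zspan2 1 \<sigma>)"
    and "ideal_class p R (zspan2 1 \<sigma>) = ideal_class p R (zspan2 1 \<tau>)"
proof -
  have "Fin \<sigma> \<in> Gamma0_orbit p (Fin \<tau>)" unfolding orb by (rule mem_Gamma0_orbit)
  then obtain A where "det A = 1" "moebius A (Fin \<tau>) = Fin \<sigma>"
    unfolding Gamma0_orbit_def Gamma0_def by fastforce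
  then obtain w where w: "w = inverse (of_int (A$2$1) * \<tau> + of_int (A$2$2))" "w \<noteq> 0"
    and L: "zspan2 1 \<sigma> = (\<lambda>x. w * x) ` zspan2 1 \<tau>"
    using \<tau> by (auto simp: upper_half_plane_def elim!: zspan2_moebius)
  have "w \<in> K_field p" unfolding w(1)
    by (intro K_field_closed \<open>\<tau> \<in> K_field p\<close> Rats_K_field) auto
  then show "ideal_class p R (zspan2 1 \<sigma>) = ideal_class p R (zspan2 1 \<tau>)"
    unfolding L using w(2) by (rule ideal_class_scale)
  show "proper_ideal p R (zspan2 1 \<sigma>)"
    using K ideal multipliers_scale[OF w(2)] unfolding L proper_ideal_def by simp
qed

lemma proper_ideal_K_field:
  assumes "proper_ideal p R (zspan2 1 \<tau>)" shows "\<tau> \<in> K_field p"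
proof -
  have "K_lattice p (zspan2 1 \<tau>)" using assms by (simp add: proper_ideal_def)
  then obtain x y where xy: "x \<in> K_field p" "y \<in> K_field p" and L: "zspan2 1 \<tau> = zspan2 x y"
    unfolding K_lattice_def by (elim bexE conjE) (rule that)
  have "\<tau> = of_int 0 * 1 + of_int 1 * \<tau>" by simp
  then have "\<tau> \<in> zspan2 x y" unfolding L[symmetric] zspan2_iff by blast
  then obtain m n where "\<tau> = of_int m * x + of_int n * y" unfolding zspan2_iff by blast
  then show ?thesis using xy by (simp add: K_field_closed Rats_K_field)
qed

text \<open>By linear independence of \<open>1\<close> and \<open>\<beta>\<close>, the generator \<open>\<beta>\<close> is not of the form
  \<open>m + 2 n \<beta>\<close>. Hence no lattice is proper for both orders.\<close>

lemma max_order_neq_order2: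
  assumes "p > 0" shows "max_order p \<noteq> order2 p"
proof
  assume eq: "max_order p = order2 p"
  have im: "Im (beta p) \<noteq> 0" using assms by (simp add: beta_def csqrt_minus_nat)
  have "beta p = of_int 0 * 1 + of_int 1 * beta p" by simp
  then have "beta p \<in> order2 p" unfolding eq[symmetric] max_order_def zspan2_iff by blast
  then obtain m n where "beta p = of_int m * 1 + of_int n * (2 * beta p)"
    unfolding order2_def zspan2_iff by blast
  then have "of_int m + of_int (2 * n - 1) * beta p = 0" by (simp add: algebra_simps)
  then have "2 * n - 1 = 0" using independent_1_nonreal[OF im] by blast
  then show False by presburger
qed

lemma max_order_1_mod_4: "p mod 4 = 1 \<Longrightarrow> max_order p = zspan2 1 (csqrt (- of_nat p))"
  by (simp add: max_order_def beta_def)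

lemma max_order_3_mod_4: "p mod 4 = 3 \<Longrightarrow> max_order p = zspan2 1 ((1 + csqrt (- of_nat p)) / 2)"
  by (simp add: max_order_def beta_def)

lemma order2_3_mod_4: "p mod 4 = 3 \<Longrightarrow> order2 p = zspan2 1 (csqrt (- of_nat p))"
  using zspan2_1_translate[of 1 1 "csqrt (- of_nat p)"]
  by (simp add: order2_def beta_def add_divide_distrib distrib_left)

theorem lemma1:
  fixes p :: nat
  assumes "prime p" and "odd p"
  shows
    "(p mod 4 = 1 \<longrightarrow>
       (\<forall>P \<in> ramification_points p.
          \<exists>!\<kappa>. \<kappa> \<in> carrier (Cl p (max_order p)) \<and>
            (\<exists>\<tau>\<in>upper_half_plane. P = Gamma0_orbit p (Fin \<tau>)) \<and>
            (\<forall>\<tau>\<in>upper_half_plane. P = Gamma0_orbit p (Fin \<tau>) \<longrightarrow>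
               proper_ideal p (max_order p) (zspan2 1 \<tau>) \<and>
               \<kappa> = ideal_class p (max_order p) (zspan2 1 \<tau>))))
     \<and>
     (p mod 4 = 3 \<longrightarrow>
       (\<forall>P \<in> ramification_points p.
          \<exists>!\<kappa>. \<kappa> \<in> carrier (Cl p (max_order p)) <+> carrier (Cl p (order2 p)) \<and>
            (\<exists>\<tau>\<in>upper_half_plane. P = Gamma0_orbit p (Fin \<tau>)) \<and>
            (\<forall>\<tau>\<in>upper_half_plane. P = Gamma0_orbit p (Fin \<tau>) \<longrightarrow>
               proper_ideal p (max_order p) (zspan2 1 \<tau>) \<and>
               \<not> proper_ideal p (order2 p) (zspan2 1 \<tau>) \<and>
               \<kappa> = Inl (ideal_class p (max_order p) (zspan2 1 \<tau>))
             \<or> proper_ideal p (order2 p) (zspan2 1 \<tau>) \<and>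
               \<not> proper_ideal p (max_order p) (zspan2 1 \<tau>) \<and>
               \<kappa> = Inr (ideal_class p (order2 p) (zspan2 1 \<tau>)))))"
proof (intro conjI impI ballI)
  fix P assume p1: "p mod 4 = 1" and P: "P \<in> ramification_points p"
  let ?R = "max_order p"
  have proper: "proper_ideal p ?R (zspan2 1 \<sigma>)"
    if "\<sigma> \<in> upper_half_plane" "P = Gamma0_orbit p (Fin \<sigma>)" for \<sigma>
    using ramification_point_order[OF assms _ that(1)] P that(2) p1
    by (simp add: max_order_1_mod_4)
  obtain \<tau> where \<tau>: "\<tau> \<in> upper_half_plane" "P = Gamma0_orbit p (Fin \<tau>)"
    using ramification_point_not_cusp[OF assms(1) P] by blast
  note ideal = proper[OF \<tau>]
  have same: "ideal_class p ?R (zspan2 1 \<sigma>) = ideal_class p ?R (zspan2 1 \<tau>)"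
    if "\<sigma> \<in> upper_half_plane" "P = Gamma0_orbit p (Fin \<sigma>)" for \<sigma>
    using orbit_ideal_class(2)[OF _ \<tau>(1) _ ideal proper_ideal_K_field[OF ideal], of \<sigma>]
      proper[OF that] \<tau>(2) that(2) by (simp add: proper_ideal_def)
  show "\<exists>!\<kappa>. \<kappa> \<in> carrier (Cl p ?R) \<and>
      (\<exists>\<tau>\<in>upper_half_plane. P = Gamma0_orbit p (Fin \<tau>)) \<and>
      (\<forall>\<tau>\<in>upper_half_plane. P = Gamma0_orbit p (Fin \<tau>) \<longrightarrow>
         proper_ideal p ?R (zspan2 1 \<tau>) \<and> \<kappa> = ideal_class p ?R (zspan2 1 \<tau>))"
  proof (rule ex1I[of _ "ideal_class p ?R (zspan2 1 \<tau>)"])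
    show "ideal_class p ?R (zspan2 1 \<tau>) \<in> carrier (Cl p ?R) \<and>
      (\<exists>\<tau>\<in>upper_half_plane. P = Gamma0_orbit p (Fin \<tau>)) \<and>
      (\<forall>\<sigma>\<in>upper_half_plane. P = Gamma0_orbit p (Fin \<sigma>) \<longrightarrow>
         proper_ideal p ?R (zspan2 1 \<sigma>) \<and>
         ideal_class p ?R (zspan2 1 \<tau>) = ideal_class p ?R (zspan2 1 \<sigma>))"
      using ideal_class_mem_Cl[OF ideal] \<tau> proper same by metis
  qed (use \<tau> in blast)
next
  fix P assume p3: "p mod 4 = 3" and P: "P \<in> ramification_points p"
  let ?R = "max_order p" and ?S = "order2 p"
  have neq: "?R \<noteq> ?S" by (rule max_order_neq_order2) (rule prime_gt_0_nat[OF assms(1)])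
  have proper: "proper_ideal p ?R (zspan2 1 \<sigma>) \<or> proper_ideal p ?S (zspan2 1 \<sigma>)"
    if "\<sigma> \<in> upper_half_plane" "P = Gamma0_orbit p (Fin \<sigma>)" for \<sigma>
    using ramification_point_order[OF assms _ that(1)] P that(2) p3
    by (auto simp: max_order_3_mod_4 order2_3_mod_4)
  have excl: "\<not> (proper_ideal p ?R L \<and> proper_ideal p ?S L)" for L
    using neq by (auto simp: proper_ideal_def)
  obtain \<tau> where \<tau>: "\<tau> \<in> upper_half_plane" "P = Gamma0_orbit p (Fin \<tau>)"
    using ramification_point_not_cusp[OF assms(1) P] by blast
  have transfer: "proper_ideal p Q (zspan2 1 \<sigma>) \<and>
      ideal_class p Q (zspan2 1 \<sigma>) = ideal_class p Q (zspan2 1 \<tau>)"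
    if "proper_ideal p Q (zspan2 1 \<tau>)" "\<sigma> \<in> upper_half_plane" "P = Gamma0_orbit p (Fin \<sigma>)" for Q \<sigma>
  proof -
    have "K_lattice p (zspan2 1 \<sigma>)" using proper[OF that(2,3)] by (auto simp: proper_ideal_def)
    then show ?thesis
      using orbit_ideal_class[OF _ \<tau>(1) _ that(1) proper_ideal_K_field[OF that(1)], of \<sigma>] \<tau>(2) that(3)
      by simp
  qed
  let ?good = "\<lambda>\<kappa> \<sigma>. proper_ideal p ?R (zspan2 1 \<sigma>) \<and> \<not> proper_ideal p ?S (zspan2 1 \<sigma>) \<and>
        \<kappa> = Inl (ideal_class p ?R (zspan2 1 \<sigma>))
      \<or> proper_ideal p ?S (zspan2 1 \<sigma>) \<and> \<not> proper_ideal p ?R (zspan2 1 \<sigma>) \<and>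
        \<kappa> = Inr (ideal_class p ?S (zspan2 1 \<sigma>))"
  have good_unique: "\<kappa> = \<kappa>'" if "?good \<kappa> \<tau>" "?good \<kappa>' \<tau>" for \<kappa> \<kappa>'
    using that by blast
  obtain \<kappa> where \<kappa>: "\<kappa> \<in> carrier (Cl p ?R) <+> carrier (Cl p ?S)"
    "\<And>\<sigma>. \<sigma> \<in> upper_half_plane \<Longrightarrow> P = Gamma0_orbit p (Fin \<sigma>) \<Longrightarrow> ?good \<kappa> \<sigma>"
  proof (cases "proper_ideal p ?R (zspan2 1 \<tau>)")
    case True
    show ?thesis
    proof (rule that)
      show "Inl (ideal_class p ?R (zspan2 1 \<tau>)) \<in> carrier (Cl p ?R) <+> carrier (Cl p ?S)"
        using ideal_class_mem_Cl[OF True] by blast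
      show "?good (Inl (ideal_class p ?R (zspan2 1 \<tau>))) \<sigma>"
        if "\<sigma> \<in> upper_half_plane" "P = Gamma0_orbit p (Fin \<sigma>)" for \<sigma>
        using transfer[OF True that] excl[of "zspan2 1 \<sigma>"] by simp
    qed
  next
    case False
    then have S: "proper_ideal p ?S (zspan2 1 \<tau>)" using proper[OF \<tau>] by blast
    show ?thesis
    proof (rule that)
      show "Inr (ideal_class p ?S (zspan2 1 \<tau>)) \<in> carrier (Cl p ?R) <+> carrier (Cl p ?S)"
        using ideal_class_mem_Cl[OF S] by blast
      show "?good (Inr (ideal_class p ?S (zspan2 1 \<tau>))) \<sigma>"
        if "\<sigma> \<in> upper_half_plane" "P = Gamma0_orbit p (Fin \<sigma>)" for \<sigma>
        using transfer[OF S that] excl[of "zspan2 1 \<sigma>"] by simp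
    qed
  qed
  show "\<exists>!\<kappa>. \<kappa> \<in> carrier (Cl p ?R) <+> carrier (Cl p ?S) \<and>
      (\<exists>\<tau>\<in>upper_half_plane. P = Gamma0_orbit p (Fin \<tau>)) \<and>
      (\<forall>\<tau>\<in>upper_half_plane. P = Gamma0_orbit p (Fin \<tau>) \<longrightarrow> ?good \<kappa> \<tau>)"
  proof (rule ex1I[of _ \<kappa>])
    show "\<kappa> \<in> carrier (Cl p ?R) <+> carrier (Cl p ?S) \<and>
      (\<exists>\<tau>\<in>upper_half_plane. P = Gamma0_orbit p (Fin \<tau>)) \<and>
      (\<forall>\<tau>\<in>upper_half_plane. P = Gamma0_orbit p (Fin \<tau>) \<longrightarrow> ?good \<kappa> \<tau>)"
      using \<kappa> \<tau> by blast
  next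
    fix \<kappa>' assume h: "\<kappa>' \<in> carrier (Cl p ?R) <+> carrier (Cl p ?S) \<and>
      (\<exists>\<tau>\<in>upper_half_plane. P = Gamma0_orbit p (Fin \<tau>)) \<and>
      (\<forall>\<tau>\<in>upper_half_plane. P = Gamma0_orbit p (Fin \<tau>) \<longrightarrow> ?good \<kappa>' \<tau>)"
    then have "?good \<kappa>' \<tau>" using \<tau> by blast
    then show "\<kappa>' = \<kappa>" using \<kappa>(2)[OF \<tau>] by (rule good_unique)
  qed
qed

end
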